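(* Let $X$ be a space having $\mathscr{Q}$, where $\mathscr{Q}$ is a closed hereditary topological property. Let $\mathscr{P}$ be a closed hereditary topological property preserved under countable sums of closed subspaces. Suppose that every space which has $\mathscr{Q}$ and contains a dense subspace having $\mathscr{P}$ itself has $\mathscr{P}$. Let $X=X_1\cup X_2\cup\cdots$, where each of $X_1,X_2,\ldots$ is a closed $\mathscr{P}$-connected subspace of $X$. If there exists a closed subspace $A$ of $X$ which is $\mathscr{P}$-connected, does not have $\mathscr{P}$, and satisfies $A\subseteq X_1\cap X_2\cap\cdots$, then $X$ is $\mathscr{P}$-connected.
   Context: A topological property is a property of topological spaces invariant under homeomorphism. A zero-set of a space $X$ is a set $f^{-1}(0)$ with $f:X\to[0,1]$ continuous; a cozero-set of $X$ is the complement in $X$ of a zero-set. $\mathrm{Coz}(X)$ denotes the set of all cozero-sets of $X$. Let $\mathscr{P}$ be a topological property. A $\mathscr{P}$-separation for a space $X$ is a pair $C,D\in\mathrm{Coz}(X)$ such that: $C$ and $D$ are disjoint; neither $\mathrm{cl}_XC$ nor $\mathrm{cl}_XD$ has $\mathscr{P}$; and $X\setminus(C\cup D)\subseteq E$ for some $E\in\mathrm{Coz}(X)$ such that $\mathrm{cl}_XE$ has $\mathscr{P}$. The space $X$ is $\mathscr{P}$-disconnected if there is a $\mathscr{P}$-separation for it, and $\mathscr{P}$-connected otherwise. A subspace is $\mathscr{P}$-connected if it is so as a space in its own right. A topological property is closed hereditary if every closed subspace of a space with the property also has the property. $\mathscr{P}$ is preserved under countable sums of closed subspaces if any space that is a countable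 union of closed subspaces each having $\mathscr{P}$ also has $\mathscr{P}$. *)

theory Defs
  imports "HOL-Analysis.Analysis"
begin

text \<open>
  A property of spaces is a predicate on \<^typ>\<open>'a topology\<close> for one carrier type \<^typ>\<open>'a\<close>;
  the hypotheses on a property below therefore range over all spaces whose points are drawn
  from \<^typ>\<open>'a\<close>. No separation axioms are imposed, and the empty space counts as a space.
  Subspaces are represented by \<^const>\<open>subtopology\<close>, which is only ever applied to subsets of
  the underlying set.
\<close>

definition topological_property :: "('a topology \<Rightarrow> bool) \<Rightarrow> bool" where
  "topological_property P \<longleftrightarrow> (\<forall>Y Z. Y homeomorphic_space Z \<longrightarrow> P Y \<longrightarrow> P Z)"

definition closed_hereditary :: "('a topology \<Rightarrow> bool) \<Rightarrow> bool" where
  "closed_hereditary P \<longleftrightarrow> (\<forall>Y S. P Y \<longrightarrow> closedin Y S \<longrightarrow> P (subtopology Y S))"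

text \<open>
  Sequences may repeat terms, so this covers finite nonempty unions as well.
\<close>

definition preserved_under_countable_closed_sums :: "('a topology \<Rightarrow> bool) \<Rightarrow> bool" where
  "preserved_under_countable_closed_sums P \<longleftrightarrow>
     (\<forall>Y (F :: nat \<Rightarrow> 'a set).
        (\<forall>n. closedin Y (F n) \<and> P (subtopology Y (F n))) \<longrightarrow>
        topspace Y = (\<Union>n. F n) \<longrightarrow> P Y)"

definition zero_set :: "'a topology \<Rightarrow> 'a set \<Rightarrow> bool" where
  "zero_set X Z \<longleftrightarrow>
     (\<exists>f. continuous_map X (top_of_set {0..1::real}) f \<and> Z = {x \<in> topspace X. f x = 0})"

definition Coz :: "'a topology \<Rightarrow> 'a set set" where
  "Coz X = {topspace X - Z | Z. zero_set X Z}"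

definition separation_mod ::
  "('a topology \<Rightarrow> bool) \<Rightarrow> 'a topology \<Rightarrow> 'a set \<Rightarrow> 'a set \<Rightarrow> bool" where
  "separation_mod P X C D \<longleftrightarrow>
     C \<in> Coz X \<and> D \<in> Coz X \<and> C \<inter> D = {} \<and>
     \<not> P (subtopology X (X closure_of C)) \<and>
     \<not> P (subtopology X (X closure_of D)) \<and>
     (\<exists>E \<in> Coz X. topspace X - (C \<union> D) \<subseteq> E \<and> P (subtopology X (X closure_of E)))"

definition disconnected_mod :: "('a topology \<Rightarrow> bool) \<Rightarrow> 'a topology \<Rightarrow> bool" where
  "disconnected_mod P X \<longleftrightarrow> (\<exists>C D. separation_mod P X C D)"

definition connected_mod :: "('a topology \<Rightarrow> bool) \<Rightarrow> 'a topology \<Rightarrow> bool" where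
  "connected_mod P X \<longleftrightarrow> \<not> disconnected_mod P X"

end

theory Submission
  imports Defs
begin

text \<open>
  A separation \<open>C, D\<close> of \<open>X\<close> traces on a closed \<open>P\<close>-connected subspace \<open>Y\<close> a pair of which one
  member has a closure with \<open>P\<close>. For \<open>Y = A\<close> it cannot be both, as otherwise \<open>A\<close> would be a finite
  union of closed subspaces with \<open>P\<close>; say it is the trace of \<open>C\<close>. The trace of \<open>D\<close> on every \<open>X\<^sub>n\<close>
  contains that on \<open>A\<close>, so on every \<open>X\<^sub>n\<close> it is again the trace of \<open>C\<close> whose closure has \<open>P\<close>.
  The union of these closures has \<open>P\<close> and is dense in \<open>cl C\<close>, which has \<open>Q\<close>; so \<open>cl C\<close> has \<open>P\<close>.
\<close>

lemma Coz_subtopology: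
  assumes "U \<in> Coz X"
  shows "Y \<inter> U \<in> Coz (subtopology X Y)"
proof -
  obtain f where f: "continuous_map X (top_of_set {0..1::real}) f"
    and U: "U = topspace X - {x \<in> topspace X. f x = 0}"
    using assms by (auto simp: Coz_def zero_set_def)
  have "zero_set (subtopology X Y) {x \<in> topspace (subtopology X Y). f x = 0}"
    unfolding zero_set_def using continuous_map_from_subtopology[OF f] by blast
  moreover have "Y \<inter> U = topspace (subtopology X Y) - {x \<in> topspace (subtopology X Y). f x = 0}"
    using U by auto
  ultimately show ?thesis
    unfolding Coz_def by blast
qed

lemma Coz_subset_topspace: "U \<in> Coz X \<Longrightarrow> U \<subseteq> topspace X"
  by (auto simp: Coz_def)

lemma separation_mod_sym: "separation_mod P X C D \<Longrightarrow> separation_mod P X D C"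
  by (auto simp: separation_mod_def Un_commute Int_commute)

lemma closure_of_subtopology_closedin:
  assumes "closedin X Y"
  shows "subtopology X Y closure_of (Y \<inter> S) = X closure_of (Y \<inter> S)"
  using closure_of_minimal[OF _ assms, of "Y \<inter> S"] by (auto simp: closure_of_subtopology)

text \<open>Allows the closure conditions for a separation of a closed subspace to be checked in
  \<open>X\<close>: closures of subsets of \<open>Y\<close> do not leave \<open>Y\<close>.\<close>

lemma subtopology_closure_of_closedin:
  assumes "closedin X Y"
  shows "subtopology (subtopology X Y) (subtopology X Y closure_of (Y \<inter> S))
       = subtopology X (X closure_of (Y \<inter> S))"
  using closure_of_minimal[OF _ assms, of "Y \<inter> S"]
  by (simp add: closure_of_subtopology_closedin[OF assms] subtopology_subtopology inf_absorb2)

lemma closed_hereditaryD: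
  assumes "closed_hereditary P" "P (subtopology X T)" "closedin X S" "S \<subseteq> T"
  shows "P (subtopology X S)"
proof -
  have "closedin (subtopology X T) S"
    using assms closedin_subset_topspace by blast
  then have "P (subtopology (subtopology X T) S)"
    using assms(1,2) by (auto simp: closed_hereditary_def)
  then show ?thesis
    using assms(4) by (simp add: subtopology_subtopology inf_absorb2)
qed

text \<open>The union may fail to be closed in \<open>X\<close>; what matters is that each
  \<open>F n\<close>, being closed in \<open>X\<close>, is closed in the union.\<close>

lemma countable_closed_sumsD:
  assumes "preserved_under_countable_closed_sums P"
    and "\<And>n::nat. closedin X (F n)" "\<And>n. P (subtopology X (F n))"
  shows "P (subtopology X (\<Union>n. F n))"
proof -
  have "closedin (subtopology X (\<Union>n. F n)) (F n)" for n
    by (rule closedin_subset_topspace[OF assms(2)]) auto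
  moreover have "subtopology (subtopology X (\<Union>n. F n)) (F n) = subtopology X (F n)" for n
    by (simp add: subtopology_subtopology inf_absorb2 UN_upper)
  moreover have "topspace (subtopology X (\<Union>n. F n)) = (\<Union>n. F n)"
    using closedin_subset[OF assms(2)] by auto
  ultimately show ?thesis
    using assms(1,3) unfolding preserved_under_countable_closed_sums_def by metis
qed

text \<open>The trace of \<open>E\<close> is a cozero-set of \<open>Y\<close> whose closure is a
  closed part of that of \<open>E\<close>, hence has \<open>P\<close>. If both closures lacked
  \<open>P\<close>, the traces of \<open>C\<close> and \<open>D\<close> would therefore separate
  \<open>Y\<close>.\<close>

lemma connected_mod_trace:
  assumes "closed_hereditary P" "separation_mod P X C D"
    and "closedin X Y" "connected_mod P (subtopology X Y)"
  shows "P (subtopology X (X closure_of (Y \<inter> C))) \<or> P (subtopology X (X closure_of (Y \<inter> D)))"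
proof (rule ccontr)
  assume neg: "\<not> ?thesis"
  obtain E where E: "E \<in> Coz X" "topspace X - (C \<union> D) \<subseteq> E" "P (subtopology X (X closure_of E))"
    and CD: "C \<in> Coz X" "D \<in> Coz X" "C \<inter> D = {}"
    using assms(2) by (auto simp: separation_mod_def)
  have "P (subtopology X (X closure_of (Y \<inter> E)))"
    using closed_hereditaryD[OF assms(1) E(3)] by (simp add: closure_of_mono)
  moreover have "topspace (subtopology X Y) - (Y \<inter> C \<union> Y \<inter> D) \<subseteq> Y \<inter> E"
    using E(2) by auto
  ultimately have "separation_mod P (subtopology X Y) (Y \<inter> C) (Y \<inter> D)"
    using neg CD E(1) unfolding separation_mod_def
    by (auto simp: subtopology_closure_of_closedin[OF assms(3)] intro!: Coz_subtopology
        bexI[of _ "Y \<inter> E"])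
  then show False
    using assms(4) by (auto simp: connected_mod_def disconnected_mod_def)
qed

lemma separation_mod_not_both_traces:
  assumes "closed_hereditary P" "preserved_under_countable_closed_sums P" "separation_mod P X C D"
    and "closedin X A" "\<not> P (subtopology X A)"
    and "P (subtopology X (X closure_of (A \<inter> C)))"
  shows "\<not> P (subtopology X (X closure_of (A \<inter> D)))"
proof
  assume D: "P (subtopology X (X closure_of (A \<inter> D)))"
  obtain E where E: "topspace X - (C \<union> D) \<subseteq> E" "P (subtopology X (X closure_of E))"
    using assms(3) by (auto simp: separation_mod_def)
  \<comment> \<open>Three closed sets covering \<open>A\<close>, written as a sequence that repeats
    the trace of \<open>E\<close> from index 2 on.\<close>
  define F :: "nat \<Rightarrow> 'a set" where
    "F n = X closure_of (A \<inter> (if n = 0 then C else if n = 1 then D else E))" for n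
  have "P (subtopology X (X closure_of (A \<inter> E)))"
    using closed_hereditaryD[OF assms(1) E(2)] by (simp add: closure_of_mono)
  then have "P (subtopology X (F n))" for n
    using assms(6) D by (simp add: F_def)
  then have "P (subtopology X (\<Union>n. F n))"
    using countable_closed_sumsD[OF assms(2), of X F] by (simp add: F_def)
  moreover have "A \<subseteq> (\<Union>n. F n)"
  proof
    fix x assume "x \<in> A"
    then have "x \<in> topspace X"
      using closedin_subset[OF assms(4)] by blast
    then have "x \<in> F 0 \<or> x \<in> F 1 \<or> x \<in> F 2"
      using \<open>x \<in> A\<close> E(1) unfolding F_def
      by (auto simp: in_closure_of)
    then show "x \<in> (\<Union>n. F n)" by blast
  qed
  ultimately show False
    using closed_hereditaryD[OF assms(1) _ assms(4), of "\<Union>n. F n"] assms(5) by blast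
qed

theorem theorem4p4:
  fixes P Q :: "'a topology \<Rightarrow> bool"
    and X :: "'a topology"
    and Xs :: "nat \<Rightarrow> 'a set"
  assumes "topological_property Q" and "closed_hereditary Q"
    and "Q X"
    and "topological_property P" and "closed_hereditary P"
    and "preserved_under_countable_closed_sums P"
    and "\<And>(Y :: 'a topology) S.
           Q Y \<Longrightarrow> S \<subseteq> topspace Y \<Longrightarrow> Y closure_of S = topspace Y \<Longrightarrow> P (subtopology Y S) \<Longrightarrow> P Y"
    and "topspace X = (\<Union>n. Xs n)"
    and "\<And>n. closedin X (Xs n)"
    and "\<And>n. connected_mod P (subtopology X (Xs n))"
    and "\<exists>A. closedin X A \<and> connected_mod P (subtopology X A)
             \<and> \<not> P (subtopology X A) \<and> A \<subseteq> (\<Inter>n. Xs n)"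
  shows "connected_mod P X"
proof (rule ccontr)
  assume "\<not> connected_mod P X"
  then obtain C D where sep: "separation_mod P X C D"
    by (auto simp: connected_mod_def disconnected_mod_def)
  obtain A where A: "closedin X A" "connected_mod P (subtopology X A)"
      "\<not> P (subtopology X A)" "A \<subseteq> (\<Inter>n. Xs n)"
    using assms(11) by blast
  \<comment> \<open>Proved for an arbitrary separation so that it applies to \<open>D, C\<close> as
    well; the two instances together contradict the connectedness of \<open>A\<close>.\<close>
  have "\<not> P (subtopology X (X closure_of (A \<inter> C)))" if sep: "separation_mod P X C D" for C D
  proof
    assume "P (subtopology X (X closure_of (A \<inter> C)))"
    then have AD: "\<not> P (subtopology X (X closure_of (A \<inter> D)))"
      by (rule separation_mod_not_both_traces[OF assms(5,6) sep A(1,3)])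
    define F where "F n = X closure_of (Xs n \<inter> C)" for n
    have "P (subtopology X (F n))" for n
    proof -
      \<comment> \<open>\<open>P\<close> for the larger closure would descend to the smaller one,
        which lacks it; so on \<open>Xs n\<close> the trace with \<open>P\<close> must be that of
        \<open>C\<close>.\<close>
      have "X closure_of (A \<inter> D) \<subseteq> X closure_of (Xs n \<inter> D)"
        using A(4) by (intro closure_of_mono) blast
      then have "\<not> P (subtopology X (X closure_of (Xs n \<inter> D)))"
        using AD closed_hereditaryD[OF assms(5) _ closedin_closure_of] by blast
      then show ?thesis
        using connected_mod_trace[OF assms(5) sep assms(9,10)] by (auto simp: F_def)
    qed
    then have PF: "P (subtopology X (\<Union>n. F n))"
      using countable_closed_sumsD[OF assms(6), of X F] by (simp add: F_def)
    let ?Y = "subtopology X (X closure_of C)"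
    have FC: "(\<Union>n. F n) \<subseteq> X closure_of C"
      by (auto simp: F_def intro: closure_of_mono[THEN subsetD])
    have C: "C \<subseteq> topspace X"
      using sep by (auto simp: separation_mod_def dest: Coz_subset_topspace)
    have CF: "C \<subseteq> (\<Union>n. F n)"
    proof
      fix x assume "x \<in> C"
      then obtain n where "x \<in> Xs n \<inter> C"
        using C assms(8) by blast
      then have "x \<in> F n"
        using C closure_of_subset[of "Xs n \<inter> C" X] by (auto simp: F_def)
      then show "x \<in> (\<Union>n. F n)" by blast
    qed
    \<comment> \<open>The dense-subspace hypothesis is applied to the closure of \<open>C\<close>,
      which inherits \<open>Q\<close> from \<open>X\<close>. The union of the \<open>F n\<close> is
      dense there because it lies between \<open>C\<close> and its closure.\<close>
    have "P ?Y"
    proof (rule assms(7))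
      show "Q ?Y"
        using assms(2,3) by (simp add: closed_hereditary_def)
      show "(\<Union>n. F n) \<subseteq> topspace ?Y"
        using FC closure_of_subset_topspace[of X C] by auto
      show "?Y closure_of (\<Union>n. F n) = topspace ?Y"
        using closure_of_mono[OF CF, of X] FC closure_of_subset_topspace[of X C]
        by (auto simp: closure_of_subtopology inf_absorb2)
      show "P (subtopology ?Y (\<Union>n. F n))"
        using PF FC by (simp add: subtopology_subtopology inf_absorb2)
    qed
    then show False
      using sep by (simp add: separation_mod_def)
  qed
  then show False
    using connected_mod_trace[OF assms(5) sep A(1,2)] sep separation_mod_sym by blast
qed

end
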